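(* Let $\mathcal{M}=\langle S,N,V\rangle$ be a neighborhood model and let $ue(\mathcal{M})$ be its ultrafilter extension for contingency logic. For all formulas $\phi\in\mathcal{L}(\nabla)$ and all ultrafilters $s$ over $S$, we have $V(\phi)\in s$ iff $ue(\mathcal{M}),s\Vdash\phi$. As a corollary, for all $w\in S$, we have $(\mathcal{M},w)\equiv_{\mathcal{L}(\nabla)}(ue(\mathcal{M}),\pi_w)$.
   Context: A neighborhood model is $\mathcal{M}=\langle S,N,V\rangle$ with $S\neq\emptyset$, $N:S\to\mathcal{P}(\mathcal{P}(S))$, $V:\mathbf{P}\to\mathcal{P}(S)$, where $\mathbf{P}$ is the set of propositional variables. $\mathcal{L}(\nabla)$ is the propositional language with $\neg,\wedge$ and a unary operator $\nabla$; $\Delta\phi$ abbreviates $\neg\nabla\phi$. Semantics: $\mathcal{M},s\Vdash\Delta\phi$ iff $V(\phi)\in N(s)$ or $\overline{V(\phi)}\in N(s)$, where $V(\phi)=\{w\in S\mid\mathcal{M},w\Vdash\phi\}$ and $\overline{X}$ denotes complement; Booleans as usual. $\equiv_{\mathcal{L}(\nabla)}$ between pointed models means satisfying the same $\mathcal{L}(\nabla)$-formulas. For $X\subseteq S$, $m_C(X)=\{s\in S\mid X\in N(s)\text{ or }\overline{X}\in N(s)\}$. The ultrafilter extension is $ue(\mathcal{M})=\langle Uf(S),N^{ue},V^{ue}\rangle$, where $Uf(S)$ is the set of all ultrafilters over $S$; $N^{ue}(s)=\{\widehat{X}\mid X\subseteq S,\ m_C(X)\in s\}$ with $\widehat{X}=\{s\in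 Uf(S)\mid X\in s\}$; and $s\in V^{ue}(p)$ iff $V(p)\in s$. For $w\in S$, $\pi_w=\{X\subseteq S\mid w\in X\}$. *)

theory Defs
  imports Main
begin

datatype 'p form =
    Atom 'p
  | Neg "'p form"
  | Conj "'p form" "'p form"
  | Nabla "'p form"

abbreviation Delta :: "'p form \<Rightarrow> 'p form" where
  "Delta \<phi> \<equiv> Neg (Nabla \<phi>)"

text \<open>The set of states is an explicit carrier inside a type, so that the ultrafilter extension
  is again a model of the same kind; complements are relative to the carrier.\<close>

record ('p, 's) model =
  states :: "'s set"
  nbhd :: "'s \<Rightarrow> 's set set"
  val :: "'p \<Rightarrow> 's set"

definition neighborhood_model :: "('p, 's) model \<Rightarrow> bool" where
  "neighborhood_model M \<longleftrightarrow>
     states M \<noteq> {} \<and>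
     (\<forall>s\<in>states M. nbhd M s \<subseteq> Pow (states M)) \<and>
     (\<forall>p. val M p \<subseteq> states M)"

primrec sat :: "('p, 's) model \<Rightarrow> 's \<Rightarrow> 'p form \<Rightarrow> bool" where
  "sat M s (Atom p) \<longleftrightarrow> s \<in> val M p"
| "sat M s (Neg \<phi>) \<longleftrightarrow> \<not> sat M s \<phi>"
| "sat M s (Conj \<phi> \<psi>) \<longleftrightarrow> sat M s \<phi> \<and> sat M s \<psi>"
| "sat M s (Nabla \<phi>) \<longleftrightarrow>
     \<not> ({w \<in> states M. sat M w \<phi>} \<in> nbhd M s \<or>
        states M - {w \<in> states M. sat M w \<phi>} \<in> nbhd M s)"

definition truth_set :: "('p, 's) model \<Rightarrow> 'p form \<Rightarrow> 's set" where
  "truth_set M \<phi> = {w \<in> states M. sat M w \<phi>}"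

text \<open>The semantic clause is usually given for the defined operator \<open>Delta\<close>.\<close>

lemma sat_Delta:
  "sat M s (Delta \<phi>) \<longleftrightarrow>
     truth_set M \<phi> \<in> nbhd M s \<or> states M - truth_set M \<phi> \<in> nbhd M s"
  by (simp add: truth_set_def)

text \<open>Equivalence of the pointed models \<open>(M, s)\<close> and \<open>(M', s')\<close>.\<close>

definition nabla_equiv ::
    "('p, 's) model \<Rightarrow> 's \<Rightarrow> ('p, 't) model \<Rightarrow> 't \<Rightarrow> bool" where
  "nabla_equiv M s M' s' \<longleftrightarrow> (\<forall>\<phi>. sat M s \<phi> \<longleftrightarrow> sat M' s' \<phi>)"

definition ultrafilter_over :: "'s set \<Rightarrow> 's set set \<Rightarrow> bool" where
  "ultrafilter_over S u \<longleftrightarrow>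
     u \<subseteq> Pow S \<and> S \<in> u \<and> {} \<notin> u \<and>
     (\<forall>X\<in>u. \<forall>Y\<in>u. X \<inter> Y \<in> u) \<and>
     (\<forall>X\<in>u. \<forall>Y. X \<subseteq> Y \<and> Y \<subseteq> S \<longrightarrow> Y \<in> u) \<and>
     (\<forall>X. X \<subseteq> S \<longrightarrow> X \<in> u \<or> S - X \<in> u)"

definition Uf :: "'s set \<Rightarrow> 's set set set" where
  "Uf S = {u. ultrafilter_over S u}"

definition principal_uf :: "'s set \<Rightarrow> 's \<Rightarrow> 's set set" where
  "principal_uf S w = {X. X \<subseteq> S \<and> w \<in> X}"

definition hat :: "'s set \<Rightarrow> 's set \<Rightarrow> 's set set set" where
  "hat S X = {u \<in> Uf S. X \<in> u}"

definition m_C :: "('p, 's) model \<Rightarrow> 's set \<Rightarrow> 's set" where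
  "m_C M X = {s \<in> states M. X \<in> nbhd M s \<or> states M - X \<in> nbhd M s}"

definition ue :: "('p, 's) model \<Rightarrow> ('p, 's set set) model" where
  "ue M =
     \<lparr> states = Uf (states M),
       nbhd = (\<lambda>u. {hat (states M) X | X. X \<subseteq> states M \<and> m_C M X \<in> u}),
       val = (\<lambda>p. {u \<in> Uf (states M). val M p \<in> u}) \<rparr>"

lemma principal_uf_in_Uf: "w \<in> S \<Longrightarrow> principal_uf S w \<in> Uf S"
  by (auto simp: Uf_def ultrafilter_over_def principal_uf_def)

lemma neighborhood_model_ue:
  assumes "neighborhood_model M"
  shows "neighborhood_model (ue M)"
  using assms principal_uf_in_Uf[of _ "states M"]
  by (fastforce simp: neighborhood_model_def ue_def hat_def)

end

theory Submission
  imports Defs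
begin

text \<open>The first claim is an induction on the formula. An ultrafilter turns intersections and
  relative complements of sets into conjunctions and negations, which settles the Boolean cases.
  For \<open>\<nabla>\<close>, the induction hypothesis says that the truth set of \<open>\<phi>\<close> in the
  extension is \<open>hat\<close> of its truth set \<open>T\<close> in \<open>M\<close>, whose set of states is
  \<open>S\<close>, so one has to know when
  \<open>hat T\<close> or its complement \<open>hat (S - T)\<close> is a neighborhood of an ultrafilter
  \<open>u\<close>. By definition \<open>hat T\<close> is one as soon as \<open>hat T = hat X\<close> for
  \<^emph>\<open>some\<close> \<open>X\<close> with \<open>m_C X \<in> u\<close>; since \<open>hat\<close> is injective
  (\<open>hat_inject\<close>), this forces \<open>X = T\<close>. As \<open>m_C\<close> is invariant under
  complement, both alternatives reduce to \<open>m_C T \<in> u\<close>, and \<open>m_C T\<close> is the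
  complement of the truth set of \<open>\<nabla>\<phi>\<close>.

  The second claim is the instance at principal ultrafilters: membership of a truth set in
  the principal ultrafilter of \<open>w\<close> is truth at \<open>w\<close>.\<close>

lemma truth_set_subset: "truth_set M \<phi> \<subseteq> states M"
  by (auto simp: truth_set_def)

lemma m_C_subset: "m_C M X \<subseteq> states M"
  by (auto simp: m_C_def)

lemma Uf_Diff_iff:
  assumes "u \<in> Uf S" "X \<subseteq> S"
  shows "S - X \<in> u \<longleftrightarrow> X \<notin> u"
proof
  assume "S - X \<in> u"
  show "X \<notin> u"
  proof
    assume "X \<in> u"
    with assms(1) \<open>S - X \<in> u\<close> have "X \<inter> (S - X) \<in> u"
      by (simp only: Uf_def ultrafilter_over_def mem_Collect_eq)
    moreover have "X \<inter> (S - X) = {}" by blast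
    ultimately show False
      using assms(1) by (simp add: Uf_def ultrafilter_over_def)
  qed
next
  assume "X \<notin> u"
  moreover have "\<forall>X. X \<subseteq> S \<longrightarrow> X \<in> u \<or> S - X \<in> u"
    using assms(1) by (simp add: Uf_def ultrafilter_over_def)
  ultimately show "S - X \<in> u"
    using assms(2) by blast
qed

lemma Uf_Int_iff:
  assumes "u \<in> Uf S" "X \<subseteq> S" "Y \<subseteq> S"
  shows "X \<inter> Y \<in> u \<longleftrightarrow> X \<in> u \<and> Y \<in> u"
proof
  assume "X \<inter> Y \<in> u"
  moreover have "X \<inter> Y \<subseteq> X" "X \<inter> Y \<subseteq> Y" by auto
  moreover have "\<forall>A\<in>u. \<forall>B. A \<subseteq> B \<and> B \<subseteq> S \<longrightarrow> B \<in> u"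
    using assms(1) by (simp add: Uf_def ultrafilter_over_def)
  ultimately show "X \<in> u \<and> Y \<in> u"
    using assms(2,3) by blast
next
  assume "X \<in> u \<and> Y \<in> u"
  with assms(1) show "X \<inter> Y \<in> u"
    by (simp add: Uf_def ultrafilter_over_def)
qed

lemma Uf_Diff_hat: "X \<subseteq> S \<Longrightarrow> Uf S - hat S X = hat S (S - X)"
  by (rule set_eqI) (simp add: hat_def Uf_Diff_iff cong: conj_cong)

text \<open>Principal ultrafilters already separate distinct sets, because \<open>X\<close> belongs to the
  one of \<open>w\<close> exactly if \<open>w \<in> X\<close>.\<close>

lemma hat_inject:
  assumes "X \<subseteq> S" "Y \<subseteq> S"
  shows "hat S X = hat S Y \<longleftrightarrow> X = Y"
proof
  assume eq: "hat S X = hat S Y"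
  have "w \<in> Z \<longleftrightarrow> principal_uf S w \<in> hat S Z" if "w \<in> S" "Z \<subseteq> S" for w Z
    using that principal_uf_in_Uf[of w S] by (simp add: hat_def) (simp add: principal_uf_def)
  with eq assms have "w \<in> X \<longleftrightarrow> w \<in> Y" if "w \<in> S" for w
    using that by metis
  with assms show "X = Y" by blast
qed simp

lemma m_C_Diff: "X \<subseteq> states M \<Longrightarrow> m_C M (states M - X) = m_C M X"
  by (simp add: m_C_def double_diff disj_commute)

lemma hat_in_nbhd_ue_iff:
  assumes "X \<subseteq> states M"
  shows "hat (states M) X \<in> nbhd (ue M) u \<longleftrightarrow> m_C M X \<in> u"
  using assms by (auto simp: ue_def hat_inject)

lemma truth_set_Nabla:
  "truth_set M (Nabla \<phi>) = states M - m_C M (truth_set M \<phi>)"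
  by (auto simp: truth_set_def m_C_def)

lemma truth_set_in_ultrafilter_iff:
  assumes M: "neighborhood_model M" and "u \<in> Uf (states M)"
  shows "truth_set M \<phi> \<in> u \<longleftrightarrow> sat (ue M) u \<phi>"
  using assms(2)
proof (induction \<phi> arbitrary: u)
  case (Atom p)
  have "truth_set M (Atom p) = val M p"
    using M by (auto simp: truth_set_def neighborhood_model_def)
  with Atom show ?case by (simp add: ue_def)
next
  case (Neg \<phi>)
  have "truth_set M (Neg \<phi>) = states M - truth_set M \<phi>"
    by (auto simp: truth_set_def)
  with Neg show ?case by (simp add: Uf_Diff_iff truth_set_subset)
next
  case (Conj \<phi> \<psi>)
  have "truth_set M (Conj \<phi> \<psi>) = truth_set M \<phi> \<inter> truth_set M \<psi>"
    by (auto simp: truth_set_def)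
  with Conj show ?case by (simp add: Uf_Int_iff truth_set_subset)
next
  case (Nabla \<phi>)
  let ?S = "states M" and ?T = "truth_set M \<phi>"
  have states: "states (ue M) = Uf ?S" by (simp add: ue_def)
  have T: "truth_set (ue M) \<phi> = hat ?S ?T"
    using Nabla.IH by (auto simp: truth_set_def[of "ue M"] states hat_def)
  have "sat (ue M) u (Nabla \<phi>) \<longleftrightarrow>
      \<not> (hat ?S ?T \<in> nbhd (ue M) u \<or> hat ?S (?S - ?T) \<in> nbhd (ue M) u)"
    using sat_Delta[of "ue M" u \<phi>]
    by (simp only: sat.simps(2) T states Uf_Diff_hat[OF truth_set_subset]) blast
  also have "\<dots> \<longleftrightarrow> m_C M ?T \<notin> u"
    by (simp add: hat_in_nbhd_ue_iff truth_set_subset m_C_Diff)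
  also have "\<dots> \<longleftrightarrow> truth_set M (Nabla \<phi>) \<in> u"
    using Nabla.prems by (simp add: truth_set_Nabla Uf_Diff_iff m_C_subset)
  finally show ?case by simp
qed

theorem proposition30:
  fixes M :: "('p, 's) model"
  assumes "neighborhood_model M"
  shows "(\<forall>\<phi>. \<forall>s\<in>Uf (states M). truth_set M \<phi> \<in> s \<longleftrightarrow> sat (ue M) s \<phi>) \<and>
         (\<forall>w\<in>states M. nabla_equiv M w (ue M) (principal_uf (states M) w))"
proof (intro conjI allI ballI)
  fix \<phi> s
  assume "s \<in> Uf (states M)"
  with assms show "truth_set M \<phi> \<in> s \<longleftrightarrow> sat (ue M) s \<phi>"
    by (rule truth_set_in_ultrafilter_iff)
next
  fix w
  assume w: "w \<in> states M"
  have "sat M w \<phi> \<longleftrightarrow> truth_set M \<phi> \<in> principal_uf (states M) w" for \<phi>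
    using w by (auto simp: principal_uf_def truth_set_def)
  then show "nabla_equiv M w (ue M) (principal_uf (states M) w)"
    using truth_set_in_ultrafilter_iff[OF assms principal_uf_in_Uf[OF w]]
    by (simp add: nabla_equiv_def)
qed

end
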